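(* For every $n\ge2$, the interval $\Xi_n=\Lambda_{2n-1}\cup\Lambda_{2n}$ is a union of adjacent translates of $\Lambda_3,\Lambda_4,\Lambda_5$, and for all $n\ge0$ $$C(\Xi_{n+2})=\delta\big(h^n(b)\big),$$ where $h$ is the morphism on $\{a,b\}^*$ given by $h(a)=aab$, $h(b)=ab$, and $\delta:\{a,b\}^*\to\{3,4,5\}^*$ is the morphism $\delta(a)=54$, $\delta(b)=34$.
   Context: Lucas numbers: $L_0=2$, $L_1=1$, $L_n=L_{n-1}+L_{n-2}$. Lucas intervals (integer intervals): $\Lambda_{2n}=[L_{2n},L_{2n+1}]$, $\Lambda_{2n+1}=[L_{2n+1}+1,L_{2n+2}-1]$ for $n\ge0$; $\Xi_n=\Lambda_{2n-1}\cup\Lambda_{2n}=[L_{2n-1}+1,L_{2n+1}]$. For $n\ge6$, $\Lambda_n$ is the union of the three consecutive disjoint intervals $\Lambda_{n-2}+L_{n-1}$, $\Lambda_{n-3}+L_n$, $\Lambda_{n-2}+L_n$, where $A+x=\{a+x:a\in A\}$. The canonical splitting of $\Lambda_n$ ($n\ge3$) into translates of $\Lambda_3,\Lambda_4,\Lambda_5$ is: $\Lambda_n$ itself for $n\in\{3,4,5\}$; for $n\ge6$, the translates of the canonical splittings of $\Lambda_{n-2},\Lambda_{n-3},\Lambda_{n-2}$ to the three pieces above. $C(\Lambda_n)$ is the word over $\{3,4,5\}$ of the indices of the successive translates in the canonical splitting of $\Lambda_n$, and $C(\Xi_n)=C(\Lambda_{2n-1})C(\Lambda_{2n})$ (concatenation).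 *)

theory Defs
  imports Main
begin

fun lucas :: "nat \<Rightarrow> int" where
  "lucas 0 = 2"
| "lucas (Suc 0) = 1"
| "lucas (Suc (Suc n)) = lucas (Suc n) + lucas n"

definition Lambda :: "nat \<Rightarrow> int set" where
  "Lambda m = (if even m then {lucas m..lucas (m + 1)} else {lucas m + 1..lucas (m + 1) - 1})"

text \<open>Only used for \<open>n \<ge> 1\<close>, where the natural-number subtraction is exact.\<close>

definition Xi :: "nat \<Rightarrow> int set" where
  "Xi n = Lambda (2 * n - 1) \<union> Lambda (2 * n)"

text \<open>
  A splitting is encoded as a list of pairs; the pair \<open>(k, x)\<close> stands for the
  translate \<open>\<Lambda>\<^sub>k + x\<close>.
\<close>

definition piece :: "nat \<times> int \<Rightarrow> int set" where
  "piece p = (\<lambda>a. a + snd p) ` Lambda (fst p)"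

definition shift :: "int \<Rightarrow> (nat \<times> int) list \<Rightarrow> (nat \<times> int) list" where
  "shift x s = map (\<lambda>(k, y). (k, y + x)) s"

definition adjacent :: "int set \<Rightarrow> int set \<Rightarrow> bool" where
  "adjacent A B \<longleftrightarrow> (\<exists>i j k. i \<le> j \<and> j < k \<and> A = {i..j} \<and> B = {j + 1..k})"

definition splits_into :: "int set \<Rightarrow> (nat \<times> int) list \<Rightarrow> bool" where
  "splits_into A s \<longleftrightarrow>
     fst ` set s \<subseteq> {3, 4, 5} \<and>
     successively adjacent (map piece s) \<and>
     A = (\<Union>p\<in>set s. piece p)"

text \<open>
  The canonical splitting of \<open>\<Lambda>\<^sub>n\<close>, from left to right. It is defined for \<open>n \<ge> 3\<close>
  only; the value for \<open>n < 3\<close> is a dummy.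
\<close>

function Lambda_splitting :: "nat \<Rightarrow> (nat \<times> int) list" where
  "Lambda_splitting n =
     (if n < 3 then []
      else if n \<le> 5 then [(n, 0)]
      else shift (lucas (n - 1)) (Lambda_splitting (n - 2)) @
           shift (lucas n) (Lambda_splitting (n - 3)) @
           shift (lucas n) (Lambda_splitting (n - 2)))"
  by auto
termination by (relation "measure id") auto

declare Lambda_splitting.simps [simp del]

definition Xi_splitting :: "nat \<Rightarrow> (nat \<times> int) list" where
  "Xi_splitting n = Lambda_splitting (2 * n - 1) @ Lambda_splitting (2 * n)"

definition C_Lambda :: "nat \<Rightarrow> nat list" where
  "C_Lambda n = map fst (Lambda_splitting n)"

definition C_Xi :: "nat \<Rightarrow> nat list" where
  "C_Xi n = C_Lambda (2 * n - 1) @ C_Lambda (2 * n)"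

datatype letter = La | Lb

definition morphism :: "('a \<Rightarrow> 'b list) \<Rightarrow> 'a list \<Rightarrow> 'b list" where
  "morphism f w = concat (map f w)"

definition h :: "letter list \<Rightarrow> letter list" where
  "h = morphism (case_letter [La, La, Lb] [La, Lb])"

definition delta :: "letter list \<Rightarrow> nat list" where
  "delta = morphism (case_letter [5, 4] [3, 4])"

end

theory Submission
  imports Defs
begin

text \<open>
  For both parities \<open>\<Lambda>\<^sub>n = [min \<Lambda>\<^sub>n, min \<Lambda>\<^bsub>n+1\<^esub>)\<close>, so the splitting is adjacent as soon as the
  endpoints of consecutive half-open pieces match, which is a Lucas identity.

  With \<open>o\<^sub>n = C(\<Lambda>\<^bsub>2n+3\<^esub>)\<close> and \<open>e\<^sub>n = C(\<Lambda>\<^bsub>2n+4\<^esub>)\<close>, the recursion of the splitting reads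
  \<open>o\<^bsub>n+2\<^esub> = o\<^bsub>n+1\<^esub> e\<^sub>n o\<^bsub>n+1\<^esub>\<close> and \<open>e\<^bsub>n+1\<^esub> = e\<^sub>n o\<^sub>n e\<^sub>n\<close>. Hence \<open>X\<^sub>n = o\<^sub>n e\<^sub>n\<close> and
  \<open>Y\<^sub>n = o\<^bsub>n+1\<^esub> e\<^sub>n\<close> satisfy \<open>X\<^bsub>n+1\<^esub> = Y\<^sub>n X\<^sub>n\<close> and \<open>Y\<^bsub>n+1\<^esub> = Y\<^sub>n Y\<^sub>n X\<^sub>n\<close>, which is also
  the recursion of \<open>\<delta>(h\<^sup>n(b))\<close> and \<open>\<delta>(h\<^sup>n(a))\<close>.
\<close>

text \<open>Threading half-open endpoints through the list gives a stronger form of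
  \<open>splits_into\<close> that composes under append and translation. Requiring
  \<open>j > i\<close> keeps every piece nonempty, as \<open>adjacent\<close> demands.\<close>

fun tiles :: "int \<Rightarrow> (nat \<times> int) list \<Rightarrow> int \<Rightarrow> bool" where
  "tiles i [] k \<longleftrightarrow> i = k"
| "tiles i (p # s) k \<longleftrightarrow> fst p \<in> {3, 4, 5} \<and> (\<exists>j>i. piece p = {i..<j} \<and> tiles j s k)"

lemma tiles_le: "tiles i s k \<Longrightarrow> i \<le> k"
  by (induction s arbitrary: i) force+

lemma tiles_append: "tiles i s j \<Longrightarrow> tiles j t k \<Longrightarrow> tiles i (s @ t) k"
  by (induction s arbitrary: i) auto

lemma piece_translate: "piece (m, y + x) = (\<lambda>a. a + x) ` piece (m, y)"
  by (auto simp: piece_def image_image add.assoc)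

lemma tiles_shift: "tiles i s k \<Longrightarrow> tiles (i + x) (shift x s) (k + x)"
proof (induction s arbitrary: i)
  case Nil
  then show ?case by (simp add: shift_def)
next
  case (Cons p s)
  obtain m y where p: "p = (m, y)" by (cases p)
  from Cons.prems obtain j where j: "m \<in> {3, 4, 5}" "i < j" "piece (m, y) = {i..<j}" "tiles j s k"
    by (auto simp: p)
  from j have "piece (m, y + x) = {i + x..<j + x}"
    by (simp add: piece_translate)
  moreover from j Cons.IH have "tiles (j + x) (shift x s) (k + x)"
    by blast
  ultimately show ?case
    using j(1,2) by (auto simp: shift_def p intro!: exI[of _ "j + x"])
qed

lemma adjacent_atLeastLessThan:
  assumes "i < j" "j < k"
  shows "adjacent {i..<j} {j..<k}"
  unfolding adjacent_def
proof (intro exI conjI)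
  show "{i..<j} = {i..j - 1}" "{j..<k} = {j - 1 + 1..k - 1}" by auto
qed (use assms in auto)

lemma tiles_splits_into: "tiles i s k \<Longrightarrow> splits_into {i..<k} s"
proof (induction s arbitrary: i)
  case Nil
  then show ?case by (simp add: splits_into_def)
next
  case (Cons p s)
  then obtain j where j: "fst p \<in> {3, 4, 5}" "i < j" "piece p = {i..<j}" "tiles j s k"
    by auto
  from Cons.IH[OF j(4)] have s: "splits_into {j..<k} s" .
  have "{i..<k} = {i..<j} \<union> {j..<k}"
    using j(2) tiles_le[OF j(4)] by auto
  moreover have "successively adjacent (map piece (p # s))"
  proof (cases s)
    case (Cons q t)
    with j(4) obtain l where "j < l" "piece q = {j..<l}" by auto
    with s j Cons show ?thesis
      by (simp add: splits_into_def adjacent_atLeastLessThan)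
  qed simp
  ultimately show ?case
    using s j by (auto simp: splits_into_def)
qed

definition Lambda_min :: "nat \<Rightarrow> int" where
  "Lambda_min n = lucas n + (if even n then 0 else 1)"

lemma Lambda_eq: "Lambda n = {Lambda_min n..<Lambda_min (n + 1)}"
  by (auto simp: Lambda_def Lambda_min_def)

lemma Lambda_splitting_rec:
  "Lambda_splitting (n + 6) =
     shift (lucas (n + 5)) (Lambda_splitting (n + 4)) @
     shift (lucas (n + 6)) (Lambda_splitting (n + 3)) @
     shift (lucas (n + 6)) (Lambda_splitting (n + 4))"
  by (subst Lambda_splitting.simps) (simp add: add.commute)

lemma Lambda_splitting_base: "n \<in> {3, 4, 5} \<Longrightarrow> Lambda_splitting n = [(n, 0)]"
  by (subst Lambda_splitting.simps) auto

lemma lucas_numeral_rec: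
  "lucas (n + 7) = lucas (n + 6) + lucas (n + 5)"
  "lucas (n + 6) = lucas (n + 5) + lucas (n + 4)"
  "lucas (n + 5) = lucas (n + 4) + lucas (n + 3)"
  by (simp_all add: eval_nat_numeral)

lemma tiles_Lambda_splitting:
  "n \<ge> 3 \<Longrightarrow> tiles (Lambda_min n) (Lambda_splitting n) (Lambda_min (n + 1))"
proof (induction n rule: less_induct)
  case (less n)
  show ?case
  proof (cases "n \<ge> 6")
    case True
    then obtain m where n: "n = m + 6"
      using le_iff_add by (metis add.commute)
    have IH: "tiles (Lambda_min (m + 4)) (Lambda_splitting (m + 4)) (Lambda_min (m + 5))"
      "tiles (Lambda_min (m + 3)) (Lambda_splitting (m + 3)) (Lambda_min (m + 4))"
      using less.IH[of "m + 4"] less.IH[of "m + 3"] by (simp_all add: n add.commute)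
    \<comment> \<open>Each equation compares \<open>Lambda_min\<close> at indices of equal parity,
      so its parity correction cancels and only the Lucas recursion remains.\<close>
    have ends:
      "Lambda_min (m + 4) + lucas (m + 5) = Lambda_min (m + 6)"
      "Lambda_min (m + 5) + lucas (m + 5) = Lambda_min (m + 3) + lucas (m + 6)"
      "Lambda_min (m + 5) + lucas (m + 6) = Lambda_min (m + 7)"
      by (simp_all add: Lambda_min_def lucas_numeral_rec)
    show ?thesis
      using tiles_shift[OF IH(1), of "lucas (m + 5)"] tiles_shift[OF IH(2), of "lucas (m + 6)"]
        tiles_shift[OF IH(1), of "lucas (m + 6)"]
      by (auto simp: n Lambda_splitting_rec ends add.commute[of 7 m] intro!: tiles_append)
  next
    case False
    with less.prems have n: "n \<in> {3, 4, 5}" by auto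
    moreover have "Lambda_min n < Lambda_min (n + 1)"
      using n by (auto simp: Lambda_min_def eval_nat_numeral)
    ultimately show ?thesis
      by (simp add: Lambda_splitting_base piece_def Lambda_eq)
  qed
qed

lemma splits_into_Xi:
  assumes "n \<ge> 2"
  shows "splits_into (Xi n) (Xi_splitting n)"
proof -
  have odd: "tiles (Lambda_min (2 * n - 1)) (Lambda_splitting (2 * n - 1)) (Lambda_min (2 * n))"
    using tiles_Lambda_splitting[of "2 * n - 1"] assms by simp
  have even: "tiles (Lambda_min (2 * n)) (Lambda_splitting (2 * n)) (Lambda_min (2 * n + 1))"
    using tiles_Lambda_splitting[of "2 * n"] assms by simp
  have "Xi n = {Lambda_min (2 * n - 1)..<Lambda_min (2 * n + 1)}"
    using tiles_le[OF odd] tiles_le[OF even] assms by (auto simp: Xi_def Lambda_eq)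
  with tiles_splits_into[OF tiles_append[OF odd even]] show ?thesis
    by (simp add: Xi_splitting_def)
qed

text \<open>Translation changes only the offsets, so the index word inherits the recursion of the
  splitting.\<close>

lemma C_Lambda_rec:
  "C_Lambda (n + 6) = C_Lambda (n + 4) @ C_Lambda (n + 3) @ C_Lambda (n + 4)"
  by (simp add: C_Lambda_def Lambda_splitting_rec shift_def case_prod_unfold o_def)

lemma C_Lambda_base: "n \<in> {3, 4, 5} \<Longrightarrow> C_Lambda n = [n]"
  by (simp add: C_Lambda_def Lambda_splitting_base)

lemma morphism_append: "morphism f (u @ v) = morphism f u @ morphism f v"
  by (simp add: morphism_def)

lemma h_funpow_append: "(h ^^ n) (u @ v) = (h ^^ n) u @ (h ^^ n) v"
  by (induction n) (simp_all add: h_def morphism_append)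

text \<open>The innermost \<open>h\<close> is expanded first; \<open>h ^^ n\<close> then distributes
  over the resulting letters.\<close>

lemma h_funpow_Suc:
  "(h ^^ Suc n) [La] = (h ^^ n) [La] @ (h ^^ n) [La] @ (h ^^ n) [Lb]"
  "(h ^^ Suc n) [Lb] = (h ^^ n) [La] @ (h ^^ n) [Lb]"
proof -
  have "h [La] = [La] @ [La] @ [Lb]" "h [Lb] = [La] @ [Lb]"
    by (simp_all add: h_def morphism_def)
  then show "(h ^^ Suc n) [La] = (h ^^ n) [La] @ (h ^^ n) [La] @ (h ^^ n) [Lb]"
    "(h ^^ Suc n) [Lb] = (h ^^ n) [La] @ (h ^^ n) [Lb]"
    by (simp_all only: funpow_Suc_right o_apply h_funpow_append)
qed

text \<open>The \<open>La\<close> half is carried along because \<open>h [Lb]\<close> contains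
  \<open>La\<close>.\<close>

lemma delta_h_funpow:
  "delta ((h ^^ n) [La]) = C_Lambda (2 * n + 5) @ C_Lambda (2 * n + 4) \<and>
   delta ((h ^^ n) [Lb]) = C_Lambda (2 * n + 3) @ C_Lambda (2 * n + 4)"
proof (induction n)
  case 0
  show ?case by (simp add: delta_def morphism_def C_Lambda_base)
next
  case (Suc n)
  have "C_Lambda (2 * n + 6) = C_Lambda (2 * n + 4) @ C_Lambda (2 * n + 3) @ C_Lambda (2 * n + 4)"
    "C_Lambda (2 * n + 7) = C_Lambda (2 * n + 5) @ C_Lambda (2 * n + 4) @ C_Lambda (2 * n + 5)"
    using C_Lambda_rec[of "2 * n"] C_Lambda_rec[of "2 * n + 1"] by (simp_all add: add.commute)
  \<comment> \<open>Only regrouping is left: if p, q, r are the words at 2n+5, 2n+4, 2n+3, then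
    (pqp)(qrq) = (pq)(pq)(rq) and p(qrq) = (pq)(rq).\<close>
  with Suc.IH show ?case
    unfolding h_funpow_Suc by (simp add: delta_def morphism_append add.commute)
qed

theorem theorem4p2:
  shows "(\<forall>n\<ge>2. splits_into (Xi n) (Xi_splitting n)) \<and>
         (\<forall>n. C_Xi (n + 2) = delta ((h ^^ n) [Lb]))"
proof (intro conjI allI impI)
  fix n :: nat
  have "2 * (n + 2) - 1 = 2 * n + 3" "2 * (n + 2) = 2 * n + 4" by simp_all
  then show "C_Xi (n + 2) = delta ((h ^^ n) [Lb])"
    by (simp only: C_Xi_def delta_h_funpow)
qed (rule splits_into_Xi)

end
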